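(* Let $n\in\mathbb N$, let $U,V\subset\mathbb R^n$ be domains, $(s,t)\subset\mathbb R$ an open interval, $b\in C^1((s,t)\times V,\mathbb R_{0,n})$, and let $\underline a=\sum_{i=1}^n a_ie_i\in C^1(U,V)$ be a diffeomorphism with real-valued components $a_i$. Let $a:(s,t)\times U\to(s,t)\times V$, $a(x)=x_0+\underline a(\underline x)$. For $f\in C^1((s,t)\times U,\mathbb R_{0,n})$ one has $H_{a,b}[f]=0$ on $(s,t)\times U$ if and only if $G[\,b\cdot(f\circ a^{-1})]=0$ on $(s,t)\times V$.
   Context: $\mathbb R_{0,n}$ is the real Clifford algebra generated by $e_1,\dots,e_n$ with $e_ie_j+e_je_i=-2\delta_{ij}$. A point $(x_0,\dots,x_n)\in\mathbb R^{n+1}$ is identified with the paravector $x=x_0+\underline x$, $\underline x=\sum_{j=1}^n x_je_j$; $|\cdot|$ is the Euclidean norm. For an open set $W\subset\mathbb R^{n+1}$ and $h\in C^1(W,\mathbb R_{0,n})$, $$G[h](x)=|\underline x|^2\frac{\partial h}{\partial x_0}(x)+\underline x\sum_{j=1}^n x_j\frac{\partial h}{\partial x_j}(x).$$ "Diffeomorphism" means a $C^1$ bijection with $C^1$ inverse. The inverse of $a$ is $a^{-1}(y)=y_0+\sum_{j=1}^n(a^{-1})_j(\underline y)e_j$, where $(a^{-1})_j$ is the $j$-th real component of $(\underline a)^{-1}$. Functions of $\underline x$ such as $\underline a$, $a_i$ are regarded as functions of $x$. For $x\in(s,t)\times U$, $$H_{a,b}[f](x)=(G[b]\circ a)(x)f(x)+|\underline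 a(x)|^2(b\circ a)(x)\frac{\partial f}{\partial x_0}(x)+\underline a(x)(b\circ a)(x)\sum_{j=1}^n\Big(\sum_{i=1}^n a_i(x)\Big(\frac{\partial(a^{-1})_j}{\partial y_i}\circ a\Big)(x)\Big)\frac{\partial f}{\partial x_j}(x).$$ *)

theory Defs
  imports "HOL-Analysis.Analysis"
begin

section \<open>The real Clifford algebra with negative definite signature\<close>

text \<open>
  The generators are indexed by a finite linearly ordered type \<^typ>\<open>'n\<close> with \<open>CARD('n) = n\<close>.
  An element is given by its real coordinates with respect to the blades
  \<open>e\<^sub>A = e\<^sub>i\<^sub>1 \<cdots> e\<^sub>i\<^sub>k\<close>, where \<open>A = {i\<^sub>1 < \<dots> < i\<^sub>k}\<close> ranges over all sets of indices.
\<close>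

typedef 'n clifford = "UNIV :: (real ^ ('n::finite) set) set"
  morphisms coords Cliff
  by simp

setup_lifting type_definition_clifford

text \<open>
  \<open>e\<^sub>A e\<^sub>B = blade_sign A B \<cdot> e\<^sub>A\<^sub>\<triangle>\<^sub>B\<close>: sorting the concatenated product needs one transposition for
  every pair \<open>j < i\<close> with \<open>i \<in> A\<close>, \<open>j \<in> B\<close>, and every common index contributes \<open>e\<^sub>i\<^sup>2 = -1\<close>.
\<close>

definition blade_sign :: "'n::{finite,linorder} set \<Rightarrow> 'n set \<Rightarrow> real" where
  "blade_sign A B = (- 1) ^ card {(i, j). i \<in> A \<and> j \<in> B \<and> j \<le> i}"

lemma minus_one_power_card_sym_diff:
  assumes "finite X" "finite Y"
  shows "(- 1 :: real) ^ card (sym_diff X Y) = (- 1) ^ card X * (- 1) ^ card Y"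
proof -
  have X: "card X = card (X - Y) + card (X \<inter> Y)"
    using assms by (metis card_Int_Diff add.commute)
  have Y: "card Y = card (Y - X) + card (X \<inter> Y)"
    using assms by (metis card_Int_Diff add.commute Int_commute)
  have "card (sym_diff X Y) = card (X - Y) + card (Y - X)"
    using assms by (intro card_Un_disjoint) auto
  then show ?thesis
    by (simp add: X Y power_add mult_ac flip: power_mult_distrib)
qed

lemma blade_sign_sym_diff_left:
  "blade_sign (sym_diff A B) C = blade_sign A C * blade_sign B C"
proof -
  have "{(i, j). i \<in> sym_diff A B \<and> j \<in> C \<and> j \<le> i} =
      sym_diff {(i, j). i \<in> A \<and> j \<in> C \<and> j \<le> i} {(i, j). i \<in> B \<and> j \<in> C \<and> j \<le> i}"
    by auto
  then show ?thesis
    unfolding blade_sign_def by (simp only: minus_one_power_card_sym_diff finite)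
qed

lemma blade_sign_sym_diff_right:
  "blade_sign A (sym_diff B C) = blade_sign A B * blade_sign A C"
proof -
  have "{(i, j). i \<in> A \<and> j \<in> sym_diff B C \<and> j \<le> i} =
      sym_diff {(i, j). i \<in> A \<and> j \<in> B \<and> j \<le> i} {(i, j). i \<in> A \<and> j \<in> C \<and> j \<le> i}"
    by auto
  then show ?thesis
    unfolding blade_sign_def by (simp only: minus_one_power_card_sym_diff finite)
qed

lemma blade_sign_empty [simp]: "blade_sign {} B = 1" "blade_sign A {} = 1"
  by (simp_all add: blade_sign_def)

subsection \<open>Vector space structure, with the Euclidean norm of the coordinates\<close>

instantiation clifford :: (finite) real_vector
begin
lift_definition zero_clifford :: "'a clifford" is 0 .
lift_definition plus_clifford :: "'a clifford \<Rightarrow> 'a clifford \<Rightarrow> 'a clifford" is "(+)" .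
lift_definition minus_clifford :: "'a clifford \<Rightarrow> 'a clifford \<Rightarrow> 'a clifford" is "(-)" .
lift_definition uminus_clifford :: "'a clifford \<Rightarrow> 'a clifford" is uminus .
lift_definition scaleR_clifford :: "real \<Rightarrow> 'a clifford \<Rightarrow> 'a clifford" is scaleR .
instance
  by standard (transfer; simp add: algebra_simps)+
end

instantiation clifford :: (finite) euclidean_space
begin
lift_definition inner_clifford :: "'a clifford \<Rightarrow> 'a clifford \<Rightarrow> real" is inner .
lift_definition norm_clifford :: "'a clifford \<Rightarrow> real" is norm .
lift_definition Basis_clifford :: "'a clifford set" is Basis .
definition dist_clifford :: "'a clifford \<Rightarrow> 'a clifford \<Rightarrow> real" where
  "dist_clifford x y = norm (x - y)"
definition sgn_clifford :: "'a clifford \<Rightarrow> 'a clifford" where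
  "sgn_clifford x = x /\<^sub>R norm x"
definition uniformity_clifford :: "('a clifford \<times> 'a clifford) filter" where
  "uniformity_clifford = (INF e\<in>{0<..}. principal {(x, y). dist x y < e})"
definition open_clifford :: "'a clifford set \<Rightarrow> bool" where
  "open_clifford S = (\<forall>x\<in>S. \<forall>\<^sub>F (x', y) in uniformity. x' = x \<longrightarrow> y \<in> S)"
instance
proof
  fix x y z :: "'a clifford" and r :: real
  show "dist x y = norm (x - y)" by (rule dist_clifford_def)
  show "sgn x = x /\<^sub>R norm x" by (rule sgn_clifford_def)
  show "(uniformity :: ('a clifford \<times> 'a clifford) filter)
      = (INF e\<in>{0<..}. principal {(x, y). dist x y < e})"
    by (rule uniformity_clifford_def)
  show "open S = (\<forall>x\<in>S. \<forall>\<^sub>F (x', y) in uniformity. x' = x \<longrightarrow> y \<in> S)"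
    for S :: "'a clifford set"
    by (rule open_clifford_def)
  show "inner x y = inner y x" by transfer (rule inner_commute)
  show "inner (x + y) z = inner x z + inner y z" by transfer (rule inner_add_left)
  show "inner (r *\<^sub>R x) y = r * inner x y" by transfer (rule inner_scaleR_left)
  show "0 \<le> inner x x" by transfer (rule inner_ge_zero)
  show "inner x x = 0 \<longleftrightarrow> x = 0" by transfer (rule inner_eq_zero_iff)
  show "norm x = sqrt (inner x x)" by transfer (rule norm_eq_sqrt_inner)
  show "(Basis :: 'a clifford set) \<noteq> {}" by transfer (rule nonempty_Basis)
  show "finite (Basis :: 'a clifford set)" by transfer (rule finite_Basis)
  show "u \<in> Basis \<Longrightarrow> v \<in> Basis \<Longrightarrow> inner u v = (if u = v then 1 else 0)"
    for u v :: "'a clifford"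
    by transfer (rule inner_Basis)
  show "(\<forall>u\<in>Basis. inner x u = 0) \<longleftrightarrow> x = 0"
    by transfer (rule euclidean_all_zero_iff)
qed
end

subsection \<open>Multiplication\<close>

instantiation clifford :: ("{finite,linorder}") real_algebra_1
begin

lift_definition one_clifford :: "'a clifford" is "axis {} 1" .

lift_definition times_clifford :: "'a clifford \<Rightarrow> 'a clifford \<Rightarrow> 'a clifford" is
  "\<lambda>x y. \<chi> C. \<Sum>(A, B) | sym_diff A B = C. blade_sign A B * (x $ A) * (y $ B)" .

lemma sum_sym_diff_eq:
  fixes g :: "'b::finite set \<Rightarrow> 'b set \<Rightarrow> real"
  shows "(\<Sum>(A, B) | sym_diff A B = C. g A B) = (\<Sum>A\<in>UNIV. g A (sym_diff A C))"
proof -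
  have *: "sym_diff A (sym_diff A B) = B" for A B :: "'b set" by auto
  show ?thesis
    by (rule sum.reindex_bij_witness[where i = "\<lambda>A. (A, sym_diff A C)" and j = fst]) (auto simp: *)
qed

instance
proof
  fix x y z :: "'a clifford" and r :: real
  show "(x * y) * z = x * (y * z)"
  proof (transfer, rule vec_eq_iff[THEN iffD2], rule allI)
    fix x y z :: "real ^ 'a set" and D :: "'a set"
    let ?s = "blade_sign :: 'a set \<Rightarrow> 'a set \<Rightarrow> real"
    define L where "L A B = ?s A B * ?s (sym_diff A B) (sym_diff (sym_diff A B) D) *
      x $ A * y $ B * z $ (sym_diff (sym_diff A B) D)" for A B
    have "(\<Sum>C\<in>UNIV. ?s C (sym_diff C D)
          * (\<Sum>A\<in>UNIV. ?s A (sym_diff A C) * x $ A * y $ sym_diff A C) * z $ sym_diff C D)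
        = (\<Sum>A\<in>UNIV. \<Sum>C\<in>UNIV. ?s C (sym_diff C D)
          * (?s A (sym_diff A C) * x $ A * y $ sym_diff A C) * z $ sym_diff C D)"
      by (subst sum.swap) (simp add: sum_distrib_left sum_distrib_right)
    also have "\<dots> = (\<Sum>A\<in>UNIV. \<Sum>B\<in>UNIV. L A B)"
    proof (rule sum.cong[OF refl])
      fix A :: "'a set"
      have *: "sym_diff A (sym_diff A B) = B" for B by auto
      show "(\<Sum>C\<in>UNIV. ?s C (sym_diff C D)
          * (?s A (sym_diff A C) * x $ A * y $ sym_diff A C) * z $ sym_diff C D)
          = (\<Sum>B\<in>UNIV. L A B)"
        by (rule sum.reindex_bij_witness[where i = "sym_diff A" and j = "sym_diff A"])
          (simp_all only: * L_def UNIV_I mult_ac)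
    qed
    also have "\<dots> = (\<Sum>A\<in>UNIV. ?s A (sym_diff A D) * x $ A *
        (\<Sum>B\<in>UNIV. ?s B (sym_diff B (sym_diff A D)) * y $ B * z $ sym_diff B (sym_diff A D)))"
    proof (simp only: sum_distrib_left, intro sum.cong refl)
      fix A B :: "'a set"
      define E where "E = sym_diff B (sym_diff A D)"
      have E: "sym_diff (sym_diff A B) D = E" "sym_diff A D = sym_diff B E"
        by (auto simp: E_def)
      show "L A B = ?s A (sym_diff A D) * x $ A *
          (?s B (sym_diff B (sym_diff A D)) * y $ B * z $ sym_diff B (sym_diff A D))"
        unfolding L_def E_def[symmetric] E(1)
        unfolding E(2) blade_sign_sym_diff_left blade_sign_sym_diff_right
        using E(2) by (simp add: E_def[symmetric] blade_sign_sym_diff_right)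
    qed
    finally show "(\<chi> C. \<Sum>(A, B) | sym_diff A B = C. ?s A B *
          (\<chi> C. \<Sum>(A, B) | sym_diff A B = C. ?s A B * x $ A * y $ B) $ A * z $ B) $ D =
        (\<chi> C. \<Sum>(A, B) | sym_diff A B = C. ?s A B * x $ A *
          (\<chi> C. \<Sum>(A, B) | sym_diff A B = C. ?s A B * y $ A * z $ B) $ B) $ D"
      by (simp only: sum_sym_diff_eq vec_lambda_beta)
  qed
  show "1 * x = x"
    by transfer (simp add: vec_eq_iff sum_sym_diff_eq axis_def if_distrib if_distribR
        cong: if_cong)
  show "x * 1 = x"
  proof (transfer, rule vec_eq_iff[THEN iffD2], rule allI)
    fix x :: "real ^ 'a set" and C :: "'a set"
    have "sym_diff A C = {} \<longleftrightarrow> A = C" for A by auto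
    then show "(\<chi> C. \<Sum>(A, B) | sym_diff A B = C. blade_sign A B * x $ A * axis {} 1 $ B) $ C
        = x $ C"
      by (simp only: sum_sym_diff_eq vec_lambda_beta axis_def)
        (simp add: if_distrib cong: if_cong)
  qed
  show "(x + y) * z = x * z + y * z"
    by transfer (simp add: vec_eq_iff sum_sym_diff_eq algebra_simps sum.distrib)
  show "x * (y + z) = x * y + x * z"
    by transfer (simp add: vec_eq_iff sum_sym_diff_eq algebra_simps sum.distrib)
  show "(r *\<^sub>R x) * y = r *\<^sub>R (x * y)"
    by transfer (simp add: vec_eq_iff sum_sym_diff_eq algebra_simps sum_distrib_left)
  show "x * (r *\<^sub>R y) = r *\<^sub>R (x * y)"
    by transfer (simp add: vec_eq_iff sum_sym_diff_eq algebra_simps sum_distrib_left)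
  show "(0 :: 'a clifford) \<noteq> 1"
    by transfer (simp add: vec_eq_iff axis_def)
qed

end

lift_definition blade :: "'n::finite set \<Rightarrow> 'n clifford" is "\<lambda>A. axis A 1" .

definition gen :: "'n::finite \<Rightarrow> 'n clifford" where
  "gen i = blade {i}"

text \<open>
  The next lemmas confirm that this is the Clifford algebra in question: the generators satisfy
  the defining relations, and their ordered products form a basis of \<open>2\<^sup>n\<close> elements.
\<close>

lemma blade_mult: "blade A * blade B = blade_sign A B *\<^sub>R blade (sym_diff A B)"
proof (transfer, rule vec_eq_iff[THEN iffD2], rule allI)
  fix A B C :: "'a set"
  have summand: "blade_sign A' (sym_diff A' C) * axis A 1 $ A' * axis B 1 $ sym_diff A' C
      = (if A' = A then blade_sign A (sym_diff A C) * axis B 1 $ sym_diff A C else 0)" for A'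
    by (simp only: axis_def vec_lambda_beta split: if_split) simp
  have "(\<chi> C. \<Sum>(A', B') | sym_diff A' B' = C.
        blade_sign A' B' * axis A 1 $ A' * axis B 1 $ B') $ C
      = blade_sign A (sym_diff A C) * axis B 1 $ sym_diff A C"
    by (simp only: sum_sym_diff_eq vec_lambda_beta summand sum.delta finite UNIV_I if_True)
  also have "\<dots> = blade_sign A B * axis (sym_diff A B) 1 $ C"
  proof (cases "sym_diff A C = B")
    case True
    then have "C = sym_diff A B" by auto
    with True show ?thesis by (simp only: axis_def vec_lambda_beta if_True refl)
  next
    case False
    then have "C \<noteq> sym_diff A B" by auto
    with False show ?thesis by (simp only: axis_def vec_lambda_beta if_False mult_zero_right)
  qed
  finally show "(\<chi> C. \<Sum>(A', B') | sym_diff A' B' = C.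
        blade_sign A' B' * axis A 1 $ A' * axis B 1 $ B') $ C
      = (blade_sign A B *\<^sub>R axis (sym_diff A B) 1) $ C"
    by (simp only: vector_scaleR_component real_scaleR_def)
qed

lemma gen_anticommute:
  "gen i * gen j + gen j * gen i = (if i = j then - 2 else 0)"
proof -
  have pairs: "{(i', j'). i' = i \<and> j' = j \<and> j' \<le> i'} = (if j \<le> i then {(i, j)} else {})"
    for i j :: 'a by auto
  have sign: "blade_sign {i} {j} = (if j \<le> i then - 1 else 1)" for i j :: 'a
    by (simp add: blade_sign_def pairs)
  have one: "blade {} = (1 :: 'a clifford)"
    by transfer simp
  show ?thesis
  proof (cases "i = j")
    case True
    have "gen j * gen j = (- 1 :: 'a clifford)"
      by (simp add: gen_def blade_mult sign one)
    with True show ?thesis by simp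
  next
    case False
    then have "blade_sign {j} {i} = - blade_sign {i} {j}" by (auto simp: sign)
    moreover have "sym_diff {j} {i} = sym_diff {i} {j}" by (rule Un_commute)
    ultimately show ?thesis
      using False by (simp only: gen_def blade_mult scaleR_minus_left if_False right_minus)
  qed
qed

lemma blade_eq_prod_gen:
  "blade A = prod_list (map gen (sorted_list_of_set A))"
proof (induction "card A" arbitrary: A)
  case 0
  then have "A = {}" by simp
  moreover have "blade {} = (1 :: 'a clifford)" by transfer simp
  ultimately show ?case by simp
next
  case (Suc k)
  then have ne: "A \<noteq> {}" by auto
  define i where "i = Min A"
  have i: "i \<in> A" "\<And>j. j \<in> A - {i} \<Longrightarrow> \<not> j \<le> i"
    using ne Min_in[of A] Min_le[of A] order.antisym[of _ "Min A"] unfolding i_def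
    by (blast intro: finite)+
  have "{(i', j). i' \<in> {i} \<and> j \<in> A - {i} \<and> j \<le> i'} = {}" using i(2) by auto
  then have "blade_sign {i} (A - {i}) = 1" by (simp only: blade_sign_def card.empty power_0)
  moreover have "sym_diff {i} (A - {i}) = A" using i(1) by auto
  ultimately have "blade A = gen i * blade (A - {i})"
    by (simp only: gen_def blade_mult scaleR_one)
  also have "blade (A - {i}) = prod_list (map gen (sorted_list_of_set (A - {i})))"
    using Suc i(1) by simp
  finally show ?case
    using ne by (simp add: i_def sorted_list_of_set_nonempty)
qed

lemma clifford_expansion: "x = (\<Sum>A\<in>UNIV. (coords x $ A) *\<^sub>R blade A)"
proof -
  have "coords (\<Sum>A\<in>S. f A) = (\<Sum>A\<in>S. coords (f A))"
    for S :: "'a set set" and f :: "'a set \<Rightarrow> 'a clifford"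
    by (induction S rule: infinite_finite_induct) (simp_all add: zero_clifford.rep_eq plus_clifford.rep_eq)
  then have "coords (\<Sum>A\<in>UNIV. (coords x $ A) *\<^sub>R blade A) = coords x"
    by (simp add: scaleR_clifford.rep_eq blade.rep_eq vec_eq_iff axis_def if_distrib cong: if_cong)
  then show ?thesis by (simp add: coords_inject)
qed

lemma DIM_clifford: "DIM('n::finite clifford) = 2 ^ CARD('n)"
proof -
  have "DIM('n clifford) = DIM(real ^ 'n set)"
    unfolding Basis_clifford_def
    by (simp add: card_image inj_on_def Cliff_inject)
  then show ?thesis by (simp add: card_Pow flip: Pow_UNIV)
qed

section \<open>Functions of a paravector variable\<close>

type_synonym 'n paravec = "real \<times> (real, 'n) vec"

text \<open>
  The space \<open>\<real>\<^sup>n\<^sup>+\<^sup>1\<close> is \<^typ>\<open>'n paravec\<close>: the pair \<open>(x\<^sub>0, v)\<close> stands for the paravector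
  \<open>x\<^sub>0 + (\<Sum>j. v\<^sub>j e\<^sub>j)\<close>, and \<open>vec_cliff v\<close> is the summand \<open>\<Sum>j. v\<^sub>j e\<^sub>j\<close>.
\<close>

definition vec_cliff :: "real ^ 'n \<Rightarrow> ('n::finite) clifford" where
  "vec_cliff v = (\<Sum>j\<in>UNIV. (v $ j) *\<^sub>R gen j)"

definition C1_on :: "'a::real_normed_vector set \<Rightarrow> ('a \<Rightarrow> 'b::real_normed_vector) \<Rightarrow> bool" where
  "C1_on W h \<longleftrightarrow> (\<exists>h' :: 'a \<Rightarrow> 'a \<Rightarrow>\<^sub>L 'b.
     (\<forall>x\<in>W. (h has_derivative blinfun_apply (h' x)) (at x)) \<and> continuous_on W h')"

definition is_domain :: "'a::topological_space set \<Rightarrow> bool" where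
  "is_domain U \<longleftrightarrow> open U \<and> connected U \<and> U \<noteq> {}"

definition C1_diffeomorphism ::
    "'a::real_normed_vector set \<Rightarrow> 'b::real_normed_vector set \<Rightarrow> ('a \<Rightarrow> 'b) \<Rightarrow> bool" where
  "C1_diffeomorphism U V g \<longleftrightarrow> bij_betw g U V \<and> C1_on U g \<and> C1_on V (inv_into U g)"

definition partial0 :: "('n::finite paravec \<Rightarrow> 'b) \<Rightarrow> 'n paravec \<Rightarrow> 'b::real_normed_vector" where
  "partial0 h x = vector_derivative (\<lambda>t. h (x + t *\<^sub>R (1, 0))) (at 0)"

definition partial ::
    "'n::finite \<Rightarrow> ('n paravec \<Rightarrow> 'b) \<Rightarrow> 'n paravec \<Rightarrow> 'b::real_normed_vector" where
  "partial j h x = vector_derivative (\<lambda>t. h (x + t *\<^sub>R (0, axis j 1))) (at 0)"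

definition G_op :: "('n paravec \<Rightarrow> 'n clifford) \<Rightarrow>
    'n paravec \<Rightarrow> ('n::{finite,linorder}) clifford" where
  "G_op h x = (norm (snd x))\<^sup>2 *\<^sub>R partial0 h x
     + vec_cliff (snd x) * (\<Sum>j\<in>UNIV. (snd x $ j) *\<^sub>R partial j h x)"

definition lift_vec :: "(real ^ 'n \<Rightarrow> real ^ 'n) \<Rightarrow> 'n paravec \<Rightarrow> 'n paravec" where
  "lift_vec g x = (fst x, g (snd x))"

text \<open>
  In \<open>H_op U a b f\<close> the argument \<open>a\<close> is the map \<open>\<underline>a\<close> on \<open>U\<close>; its domain is needed to
  form the inverse.
\<close>

definition H_op :: "(real, 'n) vec set \<Rightarrow> ((real, 'n) vec \<Rightarrow> (real, 'n) vec) \<Rightarrow>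
    ('n paravec \<Rightarrow> 'n clifford) \<Rightarrow> ('n paravec \<Rightarrow> 'n clifford) \<Rightarrow>
    'n paravec \<Rightarrow> ('n::{finite,linorder}) clifford" where
  "H_op U a b f x =
     G_op b (lift_vec a x) * f x
     + (norm (a (snd x)))\<^sup>2 *\<^sub>R (b (lift_vec a x) * partial0 f x)
     + vec_cliff (a (snd x)) * b (lift_vec a x) *
         (\<Sum>j\<in>UNIV. (\<Sum>i\<in>UNIV. a (snd x) $ i *
             partial i (\<lambda>y. inv_into U a (snd y) $ j) (lift_vec a x))
           *\<^sub>R partial j f x)"

end

theory Submission
  imports Defs
begin

text \<open>
  With \<open>y = a(x)\<close>, the product and chain rules show that \<open>H\<^bsub>a,b\<^esub>[f](x)\<close> and
  \<open>G[b \<cdot> (f \<circ> a\<^sup>-\<^sup>1)](y)\<close> are the same element; the equivalence follows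
  because \<open>a\<close> is a bijection. The sums over partial derivatives are total derivatives in the
  directions \<open>(0, y)\<close> and \<open>(0, D(a\<^sup>-\<^sup>1) y)\<close>, so no coordinates are needed.
\<close>

text \<open>Bilinearity implies boundedness because the space is finite-dimensional. The coordinate
  norm is not submultiplicative in general, so this is what gives access to the product
  rule.\<close>

lemma bounded_bilinear_clifford_mult:
  "bounded_bilinear ((*) :: 'n::{finite,linorder} clifford \<Rightarrow> 'n clifford \<Rightarrow> 'n clifford)"
  unfolding bilinear_conv_bounded_bilinear[symmetric] bilinear_def linear_iff
  by (simp add: algebra_simps)

lemma vector_derivative_along_line:
  assumes "(h has_derivative h') (at x)"
  shows "vector_derivative (\<lambda>t. h (x + t *\<^sub>R d)) (at 0) = h' d"
proof (rule vector_derivative_at)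
  have "((\<lambda>t. x + t *\<^sub>R d) has_derivative (\<lambda>t. t *\<^sub>R d)) (at 0)"
    by (auto intro!: derivative_eq_intros)
  then have "(h \<circ> (\<lambda>t. x + t *\<^sub>R d) has_derivative h' \<circ> (\<lambda>t. t *\<^sub>R d)) (at 0)"
    by (rule diff_chain_at) (use assms in simp)
  then show "((\<lambda>t. h (x + t *\<^sub>R d)) has_vector_derivative h' d) (at 0)"
    using linear_scale[OF has_derivative_linear[OF assms]]
    by (simp add: has_vector_derivative_def comp_def)
qed

lemma partial0_eq_derivative:
  "(h has_derivative h') (at x) \<Longrightarrow> partial0 h x = h' (1, 0)"
  unfolding partial0_def by (rule vector_derivative_along_line)

text \<open>Each partial is \<open>h'\<close> at a basis vector, and linearity collects them. The
  codomain is left general: the result serves the Clifford-valued \<open>b\<close> and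
  \<open>f\<close> as well as the real components of the inverse of \<open>a\<close>.\<close>

lemma sum_partial_eq_derivative:
  assumes "(h has_derivative h') (at x)"
  shows "(\<Sum>j\<in>UNIV. (v $ j) *\<^sub>R partial j h x) = h' (0, v)"
proof -
  have lin: "linear h'"
    using assms by (rule has_derivative_linear)
  have "(\<Sum>j\<in>UNIV. (v $ j) *\<^sub>R partial j h x) = (\<Sum>j\<in>UNIV. h' ((v $ j) *\<^sub>R (0, axis j 1)))"
    unfolding partial_def vector_derivative_along_line[OF assms]
    by (simp only: linear_scale[OF lin])
  also have "\<dots> = h' (\<Sum>j\<in>UNIV. (v $ j) *\<^sub>R (0, axis j 1))"
    by (simp only: linear_sum[OF lin])
  also have "(\<Sum>j\<in>UNIV. (v $ j) *\<^sub>R ((0 :: real), axis j 1)) = (0, v)"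
    using basis_expansion[of v]
    by (simp add: prod_eq_iff fst_sum snd_sum scalar_mult_eq_scaleR)
  finally show ?thesis .
qed

lemma G_op_eq_derivative:
  assumes "(h has_derivative h') (at x)"
  shows "G_op h x = (norm (snd x))\<^sup>2 *\<^sub>R h' (1, 0) + vec_cliff (snd x) * h' (0, snd x)"
  unfolding G_op_def partial0_eq_derivative[OF assms] sum_partial_eq_derivative[OF assms] ..

text \<open>In the product rule at \<open>y = lift_vec a x\<close>, the terms with \<open>b'\<close>
  form \<open>G_op b y * f x\<close>; the terms with \<open>f'\<close> give the other two summands
  of \<open>H_op\<close>. The factor \<open>b\<close> stays to the left of \<open>f\<close>, so only
  associativity of the product is needed.\<close>

lemma H_op_eq_G_op:
  fixes a :: "(real, 'n::{finite,linorder}) vec \<Rightarrow> (real, 'n) vec"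
    and b f :: "'n paravec \<Rightarrow> 'n clifford"
  assumes inv: "inv_into U a (a (snd x)) = snd x"
    and b: "(b has_derivative b') (at (lift_vec a x))"
    and f: "(f has_derivative f') (at x)"
    and g: "(inv_into U a has_derivative g') (at (a (snd x)))"
  shows "H_op U a b f x = G_op (\<lambda>y. b y * f (lift_vec (inv_into U a) y)) (lift_vec a x)"
proof -
  define y where "y = lift_vec a x"
  have sy: "snd y = a (snd x)" and xy: "lift_vec (inv_into U a) y = x"
    by (simp_all add: y_def lift_vec_def inv)
  have g_snd: "((\<lambda>y. inv_into U a (snd y)) has_derivative (\<lambda>z. g' (snd z))) (at y)"
    using diff_chain_at[OF has_derivative_snd[OF has_derivative_ident], of "inv_into U a" g' y] g
    by (simp add: sy comp_def)
  have "(lift_vec (inv_into U a) has_derivative (\<lambda>z. (fst z, g' (snd z)))) (at y)"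
    unfolding lift_vec_def
    by (intro has_derivative_Pair g_snd has_derivative_fst has_derivative_ident)
  then have "(f \<circ> lift_vec (inv_into U a) has_derivative f' \<circ> (\<lambda>z. (fst z, g' (snd z)))) (at y)"
    by (rule diff_chain_at) (simp add: xy f)
  from bounded_bilinear.FDERIV[OF bounded_bilinear_clifford_mult b[folded y_def] this]
  have "((\<lambda>y. b y * f (lift_vec (inv_into U a) y)) has_derivative
      (\<lambda>z. b y * f' (fst z, g' (snd z)) + b' z * f x)) (at y)"
    by (simp add: comp_def xy)
  note G = G_op_eq_derivative[OF this]
  \<comment> \<open>These are the coefficients of \<open>partial j f x\<close> in
    \<open>H_op\<close>, so its sum over \<open>j\<close> becomes
    \<open>f' (0, g' (a (snd x)))\<close>.\<close>
  have "(\<Sum>i\<in>UNIV. a (snd x) $ i * partial i (\<lambda>y. inv_into U a (snd y) $ j) y)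
      = g' (a (snd x)) $ j" for j
    using sum_partial_eq_derivative[OF
        bounded_linear.has_derivative[OF bounded_linear_vec_nth g_snd], of "a (snd x)" j]
    by simp
  \<comment> \<open>The chain rule sends the direction \<open>(1, 0)\<close> to
    \<open>(1, g' 0)\<close>, which must be \<open>(1, 0)\<close> to leave
    \<open>partial0 f x\<close>.\<close>
  moreover have "g' 0 = 0"
    using g by (intro linear_0 has_derivative_linear)
  ultimately show ?thesis
    unfolding H_op_def y_def[symmetric] G
    unfolding G_op_eq_derivative[OF b[folded y_def]] partial0_eq_derivative[OF f]
    by (simp add: sum_partial_eq_derivative[OF f] sy distrib_left distrib_right scaleR_add_right
        mult.assoc)
qed

theorem corollary3p3:
  fixes U V :: "(real, 'n::{finite,linorder}) vec set"
    and s t :: ereal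
    and a :: "(real, 'n) vec \<Rightarrow> (real, 'n) vec"
    and b f :: "'n paravec \<Rightarrow> 'n clifford"
  assumes "is_domain U" and "is_domain V"
    and "s < t"
    and "C1_on (einterval s t \<times> V) b"
    and "C1_diffeomorphism U V a"
    and "C1_on (einterval s t \<times> U) f"
  shows "(\<forall>x \<in> einterval s t \<times> U. H_op U a b f x = 0) \<longleftrightarrow>
    (\<forall>y \<in> einterval s t \<times> V. G_op (\<lambda>y. b y * f (lift_vec (inv_into U a) y)) y = 0)"
proof -
  have bij: "bij_betw a U V" and g: "C1_on V (inv_into U a)"
    using assms(5) by (auto simp: C1_diffeomorphism_def)
  have HG: "H_op U a b f x = G_op (\<lambda>y. b y * f (lift_vec (inv_into U a) y)) (lift_vec a x)"
    if x: "x \<in> einterval s t \<times> U" for x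
  proof -
    have aV: "a (snd x) \<in> V" and "lift_vec a x \<in> einterval s t \<times> V"
      using x bij by (auto simp: lift_vec_def bij_betw_def)
    then obtain b' f' g' where "(b has_derivative b') (at (lift_vec a x))"
      "(f has_derivative f') (at x)" "(inv_into U a has_derivative g') (at (a (snd x)))"
      using assms(4,6) g x unfolding C1_on_def by meson
    moreover have "inv_into U a (a (snd x)) = snd x"
      using x bij by (auto simp: bij_betw_def)
    ultimately show ?thesis
      by (intro H_op_eq_G_op)
  qed
  \<comment> \<open>Surjectivity lets the values at the points \<open>lift_vec a x\<close> account
    for every \<open>y\<close>.\<close>
  have "lift_vec a ` (einterval s t \<times> U) = einterval s t \<times> V"
    unfolding bij_betw_imp_surj_on[OF bij, symmetric] lift_vec_def by force
  then show ?thesis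
    using HG by (metis (mono_tags, lifting) imageE imageI)
qed

end
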